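(* Let $n,k$ be natural numbers with $k\le n$, $p$ a prime and $q=p^r$ for some positive integer $r$, and write $\mathbb{F}_q=\{0,\alpha_1,\dots,\alpha_{q-1}\}$. Then $$S_{\mathbb{F}_q}(\boldsymbol{e}_{n,k})=\sum_{m_1=0}^n \sum_{m_2=0}^{n-m_1}\cdots\sum_{m_{q-1}=0}^{n-m_{1}-\cdots-m_{q-2}} {n\choose m_0^*,m_1,m_2,\dots, m_{q-1}} \exp\left(\frac{2\pi i}{p} \mathrm{Tr}_{\mathbb{F}_q/\mathbb{F}_p}\big(\Lambda_{\alpha_1,\dots, \alpha_{q-1}}(k,m_1,\dots, m_{q-1})\big)\right),$$ where $m_0^*=n-(m_1+\cdots+m_{q-1})$.
   Context: $\boldsymbol{e}_{n,k}=\sum_{1\le i_1<\dots<i_k\le n}X_{i_1}\cdots X_{i_k}$. For $F:\mathbb{F}_q^n\to\mathbb{F}_q$, $S_{\mathbb{F}_q}(F)=\sum_{\mathbf{x}\in\mathbb{F}_q^n}\exp\!\big(\tfrac{2\pi i}{p}\mathrm{Tr}_{\mathbb{F}_q/\mathbb{F}_p}(F(\mathbf{x}))\big)$, where $\mathrm{Tr}_{\mathbb{F}_q/\mathbb{F}_p}(\alpha)=\sum_{j=0}^{r-1}\alpha^{p^j}$ with values in $\mathbb{F}_p=\{0,\dots,p-1\}$. For $a_1,a_2,\dots\in\mathbb{F}_q$, an integer $k$ and nonnegative integers $m_i$: $\Lambda_{a_1}(k,m)=a_1^k\binom{m}{k}$ (taken to be $0$ if $k<0$ or $k>m$; binomial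 coefficients mapped into $\mathbb{F}_q$; $a^0=1$), and recursively $\Lambda_{a_1,\dots,a_{l+1}}(k,m_1,\dots,m_{l+1})=\sum_{j=0}^{m_{l+1}}\binom{m_{l+1}}{j}a_{l+1}^j\Lambda_{a_1,\dots,a_l}(k-j,m_1,\dots,m_l)$. *)

theory Defs
  imports
    Complex_Main
    "HOL-Library.FuncSet"
    "HOL-Library.Cardinality"
    "HOL-Computational_Algebra.Primes"
begin

text \<open>
  Points of \<open>F\<^sup>n\<close> are the functions in \<open>{1..n} \<rightarrow>\<^sub>E UNIV\<close>. A strictly increasing index
  sequence \<open>i\<^sub>1 < \<dots> < i\<^sub>k\<close> in \<open>{1..n}\<close> is given by its set of entries.
\<close>

definition elem_sym :: "nat \<Rightarrow> nat \<Rightarrow> (nat \<Rightarrow> 'a::comm_ring_1) \<Rightarrow> 'a" where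
  "elem_sym n k x = (\<Sum>I | I \<subseteq> {1..n} \<and> card I = k. \<Prod>i\<in>I. x i)"

definition abs_trace :: "nat \<Rightarrow> nat \<Rightarrow> 'a::field \<Rightarrow> 'a" where
  "abs_trace p r \<alpha> = (\<Sum>j<r. \<alpha> ^ (p ^ j))"

text \<open>
  The trace lies in the prime field; \<open>prime_field_rep p\<close> identifies the latter with
  \<open>{0, \<dots>, p - 1}\<close>. In a field of characteristic \<open>p\<close> the description is uniquely satisfied
  exactly by the elements of the prime field.
\<close>

definition prime_field_rep :: "nat \<Rightarrow> 'a::field \<Rightarrow> nat" where
  "prime_field_rep p t = (THE j. j < p \<and> of_nat j = t)"

definition additive_char :: "nat \<Rightarrow> nat \<Rightarrow> 'a::field \<Rightarrow> complex" where
  "additive_char p r \<alpha> =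
     exp (2 * complex_of_real pi * \<i> / of_nat p * of_nat (prime_field_rep p (abs_trace p r \<alpha>)))"

definition exp_sum :: "nat \<Rightarrow> nat \<Rightarrow> nat \<Rightarrow> ((nat \<Rightarrow> 'a::{field,finite}) \<Rightarrow> 'a) \<Rightarrow> complex" where
  "exp_sum p r n F = (\<Sum>x \<in> {1..n} \<rightarrow>\<^sub>E UNIV. additive_char p r (F x))"

text \<open>
  \<open>Lambda [a\<^sub>1, \<dots>, a\<^sub>l] k [m\<^sub>1, \<dots>, m\<^sub>l]\<close>. The recursion removes the last entries of both lists;
  the last equation only makes the function total on ill-formed arguments.
\<close>

function Lambda :: "'a::field list \<Rightarrow> int \<Rightarrow> nat list \<Rightarrow> 'a" where
  "Lambda [a] k [m] =
     (if 0 \<le> k \<and> k \<le> int m then a ^ nat k * of_nat (m choose nat k) else 0)"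
| "as \<noteq> [] \<Longrightarrow> length as = length ms \<Longrightarrow>
   Lambda (as @ [a]) k (ms @ [m]) =
     (\<Sum>j = 0..m. of_nat (m choose j) * a ^ j * Lambda as (k - int j) ms)"
| "as = [] \<or> length as \<noteq> length ms \<Longrightarrow> Lambda as k ms = 0"
proof -
  fix P :: bool and x :: "'a list \<times> int \<times> nat list"
  assume base: "\<And>a k m. x = ([a], k, [m]) \<Longrightarrow> P"
    and step: "\<And>as ms a k m. as \<noteq> [] \<Longrightarrow> length as = length ms \<Longrightarrow>
      x = (as @ [a], k, ms @ [m]) \<Longrightarrow> P"
    and bad: "\<And>as ms k. as = [] \<or> length as \<noteq> length ms \<Longrightarrow> x = (as, k, ms) \<Longrightarrow> P"
  obtain as k ms where x: "x = (as, k, ms)" by (cases x)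
  show P
  proof (cases "as = [] \<or> length as \<noteq> length ms")
    case True
    then show P using bad x by blast
  next
    case False
    then have "as \<noteq> []" "ms \<noteq> []" and len: "length as = length ms" by auto
    then obtain as' a ms' m where as: "as = as' @ [a]" and ms: "ms = ms' @ [m]"
      by (metis rev_exhaust)
    show P
    proof (cases "as' = []")
      case True
      then show P using base len x as ms by simp
    next
      case False
      then show P using step len x as ms by simp
    qed
  qed
qed auto
termination
  by (relation "measure (\<lambda>(as, k, ms). length as)") auto

text \<open>\<open>multinomial [m\<^sub>0, \<dots>, m\<^sub>l]\<close> is \<open>(m\<^sub>0 + \<dots> + m\<^sub>l)! / (m\<^sub>0! \<cdots> m\<^sub>l!)\<close>; the division is exact.\<close>

definition multinomial :: "nat list \<Rightarrow> nat" where
  "multinomial ms = fact (sum_list ms) div prod_list (map fact ms)"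

text \<open>
  \<open>nested_sum l n f\<close> is the sum over \<open>m\<^sub>1\<close> from \<open>0\<close> to \<open>n\<close>, over \<open>m\<^sub>2\<close> from \<open>0\<close> to \<open>n - m\<^sub>1\<close>, \<dots>,
  over \<open>m\<^sub>l\<close> from \<open>0\<close> to \<open>n - m\<^sub>1 - \<dots> - m\<^bsub>l-1\<^esub>\<close> of \<open>f [m\<^sub>1, \<dots>, m\<^sub>l]\<close>.
\<close>

primrec nested_sum :: "nat \<Rightarrow> nat \<Rightarrow> (nat list \<Rightarrow> complex) \<Rightarrow> complex" where
  "nested_sum 0 n f = f []"
| "nested_sum (Suc l) n f = (\<Sum>m = 0..n. nested_sum l (n - m) (\<lambda>ms. f (m # ms)))"

end

theory Submission
  imports Defs "HOL-Computational_Algebra.Polynomial"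
begin

text \<open>
  Both \<open>elem_sym n k x\<close> and \<open>Lambda\<close> are coefficients at \<open>T\<^sup>k\<close> of one polynomial: of
  \<open>\<Prod>\<^sub>i (1 + x\<^sub>i T)\<close>, and of the same product collected by values,
  \<open>\<Prod>\<^sub>j (1 + \<alpha>\<^sub>j T)\<^bsup>m\<^sub>j\<^esup>\<close> with \<open>m\<^sub>j\<close> the number of coordinates equal to \<open>\<alpha>\<^sub>j\<close>. The value \<open>0\<close>
  contributes the factor \<open>1\<close>. It remains to count the points with prescribed multiplicities;
  this works for any function of \<open>\<Prod>\<^sub>i f(x\<^sub>i)\<close>, by splitting off one value at a time.
\<close>

section \<open>Elementary symmetric polynomials and \<open>Lambda\<close> as polynomial
  coefficients\<close>

lemma prod_monom_one:
  fixes x :: "'b \<Rightarrow> 'c::comm_semiring_1"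
  shows "finite I \<Longrightarrow> (\<Prod>i\<in>I. monom (x i) 1) = monom (\<Prod>i\<in>I. x i) (card I)"
  by (induction I rule: finite_induct) (auto simp: mult_monom)

text \<open>Expanding the product chooses from each factor either the linear term or 1. The set
  \<open>I\<close> of indices where the linear term is chosen contributes a monomial of degree
  \<open>card I\<close>.\<close>

lemma elem_sym_eq_coeff:
  "elem_sym n k x = coeff (\<Prod>i\<in>{1..n}. [:1, x i:]) k"
proof -
  have "(\<Prod>i\<in>{1..n}. [:1, x i:]) = (\<Prod>i\<in>{1..n}. 1 + monom (x i) 1)"
    by (intro prod.cong refl) (simp add: monom_altdef one_pCons)
  also have "\<dots> = (\<Prod>i\<in>{1..n}. monom (x i) 1 + 1)"
    by (simp add: add.commute)
  also have "\<dots> = (\<Sum>I\<in>Pow {1..n}. \<Prod>i\<in>I. monom (x i) 1)"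
    by (subst prod_add) simp_all
  also have "\<dots> = (\<Sum>I\<in>Pow {1..n}. monom (\<Prod>i\<in>I. x i) (card I))"
    by (intro sum.cong refl prod_monom_one) (auto intro: finite_subset)
  finally have "coeff (\<Prod>i\<in>{1..n}. [:1, x i:]) k
      = (\<Sum>I\<in>Pow {1..n}. if card I = k then \<Prod>i\<in>I. x i else 0)"
    by (simp add: coeff_sum)
  also have "\<dots> = (\<Sum>I | I \<in> Pow {1..n} \<and> card I = k. \<Prod>i\<in>I. x i)"
    by (rule sum.inter_filter [symmetric]) simp
  finally show ?thesis
    by (simp add: elem_sym_def)
qed

text \<open>The binomial theorem with no bound on \<open>j\<close>: beyond the degree both sides
  vanish.\<close>

lemma coeff_one_linear_power:
  fixes a :: "'a::comm_ring_1"
  shows "coeff ([:1, a:] ^ m) j = of_nat (m choose j) * a ^ j"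
proof (cases "j \<le> m")
  case False
  have "degree ([:1, a:] ^ m) \<le> 1 * m"
    using degree_power_le [of "[:1, a:]" m] by (auto split: if_splits)
  then show ?thesis
    using False by (simp add: coeff_eq_0 binomial_eq_0)
qed (simp add: coeff_linear_poly_power)

text \<open>The recursion for \<open>Lambda\<close> is the Cauchy product with one more factor.
  Reverse induction follows its removal of last entries, and \<open>k\<close> varies because the
  recursion shifts it, possibly below 0, where coefficients count as 0.\<close>

lemma Lambda_eq_coeff:
  fixes as :: "'a::field list"
  assumes "as \<noteq> []" "length as = length ms"
  shows "Lambda as k ms =
    (if 0 \<le> k then coeff (prod_list (map2 (\<lambda>a m. [:1, a:] ^ m) as ms)) (nat k) else 0)"
  using assms
proof (induction as arbitrary: ms k rule: rev_induct)
  case (snoc a as)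
  then obtain ms' m where ms: "ms = ms' @ [m]" and len: "length as = length ms'"
    by (cases ms rule: rev_cases) auto
  define P where "P = prod_list (map2 (\<lambda>a m. [:1, a:] ^ m) as ms')"
  show ?case
  proof (cases "as = []")
    case True
    then show ?thesis
      using len by (auto simp: ms coeff_one_linear_power mult.commute binomial_eq_0)
  next
    case False
    have "Lambda (as @ [a]) k ms =
        (\<Sum>j = 0..m. of_nat (m choose j) * a ^ j * (if int j \<le> k then coeff P (nat (k - int j)) else 0))"
      unfolding ms Lambda.simps(2) [OF False len]
      by (intro sum.cong refl) (simp add: snoc.IH [OF False len] P_def)
    also have "\<dots> = (if 0 \<le> k then coeff (P * [:1, a:] ^ m) (nat k) else 0)"
    proof (cases "0 \<le> k")
      case True
      \<comment> \<open>The two ranges differ only in zero terms: the binomial vanishes for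
        \<open>j > m\<close>, the guarded coefficient for \<open>int j > k\<close>.\<close>
      have "(\<Sum>j = 0..m. of_nat (m choose j) * a ^ j * (if int j \<le> k then coeff P (nat (k - int j)) else 0))
          = (\<Sum>j \<le> nat k. of_nat (m choose j) * a ^ j * coeff P (nat k - j))"
        using True by (intro sum.mono_neutral_cong) (auto simp: nat_diff_distrib binomial_eq_0)
      also have "\<dots> = coeff ([:1, a:] ^ m * P) (nat k)"
        by (simp add: coeff_mult coeff_one_linear_power)
      finally show ?thesis
        using True by (simp add: mult.commute)
    qed (auto intro!: sum.neutral)
    finally show ?thesis
      using len by (simp add: ms P_def)
  qed
qed simp

section \<open>Nested sums and multinomial coefficients\<close>

text \<open>The shrinking summation bounds keep the total at most \<open>n\<close>. Having this as a
  premise makes the truncated subtraction in \<open>n - sum_list ms\<close> harmless later.\<close>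

lemma nested_sum_cong:
  assumes "\<And>ms. length ms = l \<Longrightarrow> sum_list ms \<le> n \<Longrightarrow> f ms = g ms"
  shows "nested_sum l n f = nested_sum l n g"
  using assms
proof (induction l arbitrary: n f g)
  case (Suc l)
  have "nested_sum l (n - m) (\<lambda>ms. f (m # ms)) = nested_sum l (n - m) (\<lambda>ms. g (m # ms))"
    if "m \<in> {0..n}" for m
    using that by (intro Suc.IH Suc.prems) auto
  then show ?case by simp
qed simp

lemma nested_sum_distrib_left: "c * nested_sum l n f = nested_sum l n (\<lambda>ms. c * f ms)"
  by (induction l arbitrary: n f) (simp_all add: sum_distrib_left)

lemma prod_list_fact_dvd: "prod_list (map fact ms) dvd (fact (sum_list ms) :: nat)"
proof (induction ms)
  case (Cons m ms)
  then have "fact m * prod_list (map fact ms) dvd (fact m * fact (sum_list ms) :: nat)"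
    by (rule mult_dvd_mono [OF dvd_refl])
  also have "\<dots> dvd fact (m + sum_list ms)"
    by (rule fact_fact_dvd_fact)
  finally show ?case by simp
qed simp

lemma multinomial_mult_prod_fact: "multinomial ms * prod_list (map fact ms) = fact (sum_list ms)"
  by (simp add: multinomial_def prod_list_fact_dvd)

text \<open>Choose the \<open>m\<close> positions first, then distribute the rest; the proof cancels
  the common product of factorials. The entry \<open>a\<close> stays in front as the multiplicity of
  the value that is never split off.\<close>

lemma multinomial_Cons_Cons:
  "multinomial (a # m # ms) = ((a + m + sum_list ms) choose m) * multinomial (a # ms)"
proof -
  let ?d = "prod_list (map fact (a # m # ms)) :: nat" and ?s = "a + sum_list ms"
  have "((m + ?s) choose m) * multinomial (a # ms) * ?d
      = ((m + ?s) choose m) * fact m * (multinomial (a # ms) * prod_list (map fact (a # ms)))"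
    by (simp add: algebra_simps)
  also have "\<dots> = fact m * fact ?s * ((m + ?s) choose m)"
    unfolding multinomial_mult_prod_fact by simp
  also have "\<dots> = fact (m + ?s)"
    using binomial_fact_lemma [of m "m + ?s"] by simp
  also have "\<dots> = multinomial (a # m # ms) * ?d"
    using multinomial_mult_prod_fact [of "a # m # ms"] by (simp add: add_ac)
  finally have "((m + ?s) choose m) * multinomial (a # ms) * ?d = multinomial (a # m # ms) * ?d" .
  moreover have "?d \<noteq> 0"
    by (auto simp: prod_list_zero_iff)
  ultimately show ?thesis
    by (simp add: add_ac)
qed

section \<open>Counting points by the multiplicities of their values\<close>

text \<open>A function is determined by its fibre \<open>B\<close> over \<open>c\<close> and its
  restriction to \<open>A - B\<close>. Since \<open>c\<close> is not in \<open>S\<close>, the fibre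
  can be recovered from the glued function.\<close>

lemma sum_PiE_insert_range:
  fixes H :: "('b \<Rightarrow> 'c) \<Rightarrow> 'd::comm_monoid_add"
  assumes "finite A" "finite S" "c \<notin> S"
  shows "(\<Sum>x \<in> A \<rightarrow>\<^sub>E insert c S. H x) =
    (\<Sum>B\<in>Pow A. \<Sum>y \<in> (A - B) \<rightarrow>\<^sub>E S. H (\<lambda>i. if i \<in> B then c else y i))"
proof -
  have "(\<Sum>B\<in>Pow A. \<Sum>y \<in> (A - B) \<rightarrow>\<^sub>E S. H (\<lambda>i. if i \<in> B then c else y i)) =
      (\<Sum>(B, y) \<in> Sigma (Pow A) (\<lambda>B. (A - B) \<rightarrow>\<^sub>E S). H (\<lambda>i. if i \<in> B then c else y i))"
    using assms by (intro sum.Sigma) (auto intro!: finite_PiE)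
  also have "\<dots> = (\<Sum>x \<in> A \<rightarrow>\<^sub>E insert c S. H x)"
  proof (rule sum.reindex_bij_witness
      [where i = "\<lambda>x. ({i \<in> A. x i = c}, restrict x {i \<in> A. x i \<noteq> c})"
         and j = "\<lambda>(B, y) i. if i \<in> B then c else y i"])
    fix z assume z: "z \<in> Sigma (Pow A) (\<lambda>B. (A - B) \<rightarrow>\<^sub>E S)"
    obtain B y where [simp]: "z = (B, y)" by (cases z)
    have B: "B \<subseteq> A" and y: "y \<in> (A - B) \<rightarrow>\<^sub>E S" using z by auto
    have ne: "y i \<noteq> c" if "i \<in> A" "i \<notin> B" for i
      using that y assms(3) by (metis DiffI PiE_mem)
    have "{i \<in> A. (if i \<in> B then c else y i) = c} = B"
      using B ne by auto
    moreover have "restrict (\<lambda>i. if i \<in> B then c else y i) {i \<in> A. (if i \<in> B then c else y i) \<noteq> c} = y"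
      using B ne PiE_arb [OF y] by (fastforce simp: restrict_def fun_eq_iff)
    ultimately show "({i \<in> A. (case z of (B, y) \<Rightarrow> \<lambda>i. if i \<in> B then c else y i) i = c},
        restrict (case z of (B, y) \<Rightarrow> \<lambda>i. if i \<in> B then c else y i)
          {i \<in> A. (case z of (B, y) \<Rightarrow> \<lambda>i. if i \<in> B then c else y i) i \<noteq> c}) = z"
      by simp
    show "(case z of (B, y) \<Rightarrow> \<lambda>i. if i \<in> B then c else y i) \<in> A \<rightarrow>\<^sub>E insert c S"
      using B y by (auto simp: PiE_iff extensional_def)
  next
    fix x assume x: "x \<in> A \<rightarrow>\<^sub>E insert c S"
    show "(case ({i \<in> A. x i = c}, restrict x {i \<in> A. x i \<noteq> c}) of
        (B, y) \<Rightarrow> \<lambda>i. if i \<in> B then c else y i) = x"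
      using x by (auto simp: fun_eq_iff PiE_iff extensional_def)
    show "({i \<in> A. x i = c}, restrict x {i \<in> A. x i \<noteq> c}) \<in> Sigma (Pow A) (\<lambda>B. (A - B) \<rightarrow>\<^sub>E S)"
      using x by (auto simp: PiE_iff extensional_def)
  qed auto
  finally show ?thesis by simp
qed

lemma sum_Pow_card:
  fixes h :: "nat \<Rightarrow> 'c::semiring_1"
  assumes "finite A"
  shows "(\<Sum>B\<in>Pow A. h (card B)) = (\<Sum>m = 0..card A. of_nat (card A choose m) * h m)"
proof -
  have "(\<Sum>B\<in>Pow A. h (card B)) = (\<Sum>m = 0..card A. \<Sum>B | B \<in> Pow A \<and> card B = m. h (card B))"
    using assms by (intro sum.group [symmetric]) (auto intro: card_mono)
  also have "\<dots> = (\<Sum>m = 0..card A. of_nat (card A choose m) * h m)"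
    using assms by (simp add: n_subsets)
  finally show ?thesis .
qed

text \<open>Induction on the values, splitting off the fibre of one value at a time.
  \<open>G\<close> must be arbitrary: the factor contributed by that fibre is absorbed into it. The
  value \<open>c\<^sub>0\<close> takes all positions left over.\<close>

lemma sum_PiE_by_multiplicities:
  fixes f :: "'b \<Rightarrow> 'c::comm_monoid_mult" and G :: "'c \<Rightarrow> complex"
  assumes "finite A" "distinct (c\<^sub>0 # cs)"
  shows "(\<Sum>x \<in> A \<rightarrow>\<^sub>E set (c\<^sub>0 # cs). G (\<Prod>i\<in>A. f (x i))) =
    nested_sum (length cs) (card A) (\<lambda>ms.
      of_nat (multinomial ((card A - sum_list ms) # ms)) *
      G (f c\<^sub>0 ^ (card A - sum_list ms) * prod_list (map2 (\<lambda>c m. f c ^ m) cs ms)))"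
  using assms
proof (induction cs arbitrary: A G)
  case Nil
  have "A \<rightarrow>\<^sub>E {c\<^sub>0} = {\<lambda>i\<in>A. c\<^sub>0}"
    by (auto simp: PiE_iff extensional_def fun_eq_iff)
  then show ?case
    by (simp add: multinomial_def)
next
  case (Cons c cs)
  let ?N = "card A"
  \<comment> \<open>The summand that the induction hypothesis yields on the complement of a fibre of
    size \<open>m\<close>, with the fibre's factor \<open>f c ^ m\<close> inside
    \<open>G\<close>.\<close>
  define F where "F m = (\<lambda>ms. of_nat (multinomial ((?N - m - sum_list ms) # ms)) *
      G (f c ^ m * (f c\<^sub>0 ^ (?N - m - sum_list ms) * prod_list (map2 (\<lambda>c m. f c ^ m) cs ms))))" for m
  have inner: "(\<Sum>y \<in> (A - B) \<rightarrow>\<^sub>E set (c\<^sub>0 # cs). G (\<Prod>i\<in>A. f (if i \<in> B then c else y i)))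
      = nested_sum (length cs) (?N - card B) (F (card B))" if "B \<in> Pow A" for B
  proof -
    have B: "B \<subseteq> A" "finite B" using that Cons.prems finite_subset by auto
    have "(\<Prod>i\<in>A. f (if i \<in> B then c else y i)) = f c ^ card B * (\<Prod>i\<in>A - B. f (y i))" for y
      using prod.subset_diff [OF B(1) Cons.prems(1), of "\<lambda>i. f (if i \<in> B then c else y i)"]
      by (simp add: mult.commute)
    then show ?thesis
      using Cons.IH [of "A - B" "\<lambda>z. G (f c ^ card B * z)"] Cons.prems B
      by (simp add: F_def card_Diff_subset)
  qed
  have "(\<Sum>x \<in> A \<rightarrow>\<^sub>E set (c\<^sub>0 # c # cs). G (\<Prod>i\<in>A. f (x i)))
      = (\<Sum>x \<in> A \<rightarrow>\<^sub>E insert c (set (c\<^sub>0 # cs)). G (\<Prod>i\<in>A. f (x i)))"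
    by (simp add: insert_commute)
  also have "\<dots> = (\<Sum>B\<in>Pow A. nested_sum (length cs) (?N - card B) (F (card B)))"
    using Cons.prems by (subst sum_PiE_insert_range) (auto intro!: sum.cong inner [simplified])
  also have "\<dots> = (\<Sum>m = 0..?N. of_nat (?N choose m) * nested_sum (length cs) (?N - m) (F m))"
    using sum_Pow_card [OF Cons.prems(1), of "\<lambda>m. nested_sum (length cs) (?N - m) (F m)"] .
  also have "\<dots> = (\<Sum>m = 0..?N. nested_sum (length cs) (?N - m) (\<lambda>ms.
      of_nat (multinomial ((?N - sum_list (m # ms)) # m # ms)) *
      G (f c\<^sub>0 ^ (?N - sum_list (m # ms)) * prod_list (map2 (\<lambda>c m. f c ^ m) (c # cs) (m # ms)))))"
    unfolding nested_sum_distrib_left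
  proof (intro sum.cong refl nested_sum_cong)
    fix m ms assume "m \<in> {0..?N}" "sum_list ms \<le> ?N - m"
    \<comment> \<open>No subtraction truncates here, so the binomial in
      \<open>multinomial_Cons_Cons\<close> is \<open>?N choose m\<close>.\<close>
    then have "?N - m - sum_list ms + m + sum_list ms = ?N" by simp
    then show "of_nat (?N choose m) * F m ms =
        of_nat (multinomial ((?N - sum_list (m # ms)) # m # ms)) *
        G (f c\<^sub>0 ^ (?N - sum_list (m # ms)) * prod_list (map2 (\<lambda>c m. f c ^ m) (c # cs) (m # ms)))"
      by (simp add: F_def multinomial_Cons_Cons mult_ac)
  qed
  finally show ?case by simp
qed

theorem theorem3p2:
  fixes n k p q r :: nat
    and \<alpha>s :: "'a::{field,finite} list"
  assumes "k \<le> n"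
    and "prime p"
    and "r > 0"
    and "q = p ^ r"
    and "CARD('a) = q"
    and "distinct \<alpha>s"
    and "set \<alpha>s = UNIV - {0}"
  shows "exp_sum p r n (elem_sym n k :: (nat \<Rightarrow> 'a) \<Rightarrow> 'a) =
    nested_sum (q - 1) n (\<lambda>ms.
      of_nat (multinomial ((n - sum_list ms) # ms)) *
      additive_char p r (Lambda \<alpha>s (int k) ms))"
proof -
  have len: "length \<alpha>s = q - 1"
    using assms distinct_card [of \<alpha>s] by (simp add: card_Diff_singleton)
  \<comment> \<open>The list contains 1. The empty list must be excluded, since there
    \<open>Lambda\<close> is 0 by default while the empty product has constant coefficient
    1.\<close>
  have ne: "\<alpha>s \<noteq> []"
    using assms(7) by (metis DiffI UNIV_I empty_iff list.set(1) singletonD zero_neq_one)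
  have UNIV: "set (0 # \<alpha>s) = UNIV"
    using assms(7) by auto
  have "exp_sum p r n (elem_sym n k :: (nat \<Rightarrow> 'a) \<Rightarrow> 'a) =
      (\<Sum>x \<in> {1..n} \<rightarrow>\<^sub>E set (0 # \<alpha>s).
        additive_char p r (coeff (\<Prod>i\<in>{1..n}. [:1, x i:]) k))"
    unfolding exp_sum_def UNIV elem_sym_eq_coeff ..
  \<comment> \<open>Here 0 plays the role of \<open>c\<^sub>0\<close>, so its multiplicity is the
    remainder \<open>n - sum_list ms\<close>, and \<open>G\<close> reads off the coefficient at
    \<open>k\<close> before applying the character.\<close>
  also have "\<dots> = nested_sum (length \<alpha>s) n (\<lambda>ms.
      of_nat (multinomial ((n - sum_list ms) # ms)) *
      additive_char p r (coeff ([:1, 0:] ^ (n - sum_list ms) *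
        prod_list (map2 (\<lambda>a m. [:1, a:] ^ m) \<alpha>s ms)) k))"
    using sum_PiE_by_multiplicities [of "{1..n}" 0 \<alpha>s "\<lambda>P. additive_char p r (coeff P k)"
        "\<lambda>a. [:1, a:]"] assms(6,7) by simp
  also have "\<dots> = nested_sum (q - 1) n (\<lambda>ms.
      of_nat (multinomial ((n - sum_list ms) # ms)) *
      additive_char p r (Lambda \<alpha>s (int k) ms))"
    unfolding len using ne len
    by (intro nested_sum_cong) (simp add: Lambda_eq_coeff flip: one_pCons)
  finally show ?thesis .
qed

end
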